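(* Let $T$ be a $2$-homogeneous tree rooted at $o$, let $\phi:T\to T$ be a self map and let $1\le p<\infty$. Then $C_\phi$ is compact on $\mathbb{T}_p$ if and only if $\phi$ is a bounded self map of $T$.
   Context: $\mathbb{N}=\{1,2,\ldots\}$, $\mathbb{N}_0=\mathbb{N}\cup\{0\}$. A $2$-homogeneous tree is an (infinite) connected graph without cycles in which every vertex has exactly $2$ neighbours; it is rooted at a fixed vertex $o$. We identify $T$ with its vertex set, and $|v|$ denotes the number of edges in the unique path from $o$ to $v$. A self map of $T$ is an arbitrary function $\phi:T\to T$ on vertices; it is called bounded if $\sup\{|\phi(v)| : v\in T\}<\infty$. For $f:T\to\mathbb{C}$ put $M_p(0,f)=|f(o)|$ and, for $n\in\mathbb{N}$, $M_p(n,f)=\left(\frac{1}{2}\sum_{|v|=n}|f(v)|^p\right)^{1/p}$ (there are exactly $2$ vertices with $|v|=n$). Let $\|f\|_p=\sup_{n\in\mathbb{N}_0}M_p(n,f)$ and $\mathbb{T}_p=\{f:T\to\mathbb{C} : \|f\|_p<\infty\}$, a Banach space under $\|\cdot\|_p$. The composition operator is $C_\phi f=f\circ\phi$. $C_\phi$ is compact on $\mathbb{T}_p$ if it is a bounded linear operator from $\mathbb{T}_p$ to itself and the image $\{C_\phi f : \|f\|_p\le 1\}$ of the closed unit ball has compact closure in $\mathbb{T}_p$. *)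

theory Defs
  imports "HOL-Analysis.Analysis"
begin

text \<open>
  A simple graph whose vertex set is the whole type \<open>'v\<close> is given by a symmetric, irreflexive
  relation \<open>E\<close>, each edge being recorded in both directions. Paths and cycles are lists of vertices.
\<close>

definition graph_path :: "('v \<times> 'v) set \<Rightarrow> 'v \<Rightarrow> 'v list \<Rightarrow> 'v \<Rightarrow> bool" where
  "graph_path E u xs v \<longleftrightarrow>
     xs \<noteq> [] \<and> hd xs = u \<and> last xs = v \<and> distinct xs \<and> successively (\<lambda>x y. (x, y) \<in> E) xs"

text \<open>The bound on the length excludes the back-and-forth walk along one edge.\<close>

definition graph_cycle :: "('v \<times> 'v) set \<Rightarrow> 'v list \<Rightarrow> bool" where
  "graph_cycle E xs \<longleftrightarrow>
     3 \<le> length xs \<and> distinct xs \<and> successively (\<lambda>x y. (x, y) \<in> E) xs \<and> (last xs, hd xs) \<in> E"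

definition two_homogeneous_tree :: "('v \<times> 'v) set \<Rightarrow> bool" where
  "two_homogeneous_tree E \<longleftrightarrow>
     sym E \<and> irrefl E \<and> infinite (UNIV :: 'v set) \<and>
     (\<forall>u v. \<exists>xs. graph_path E u xs v) \<and>
     (\<nexists>xs. graph_cycle E xs) \<and>
     (\<forall>v. card {w. (v, w) \<in> E} = 2)"

text \<open>A path through \<open>k\<close> vertices has \<open>k - 1\<close> edges.\<close>

definition level :: "('v \<times> 'v) set \<Rightarrow> 'v \<Rightarrow> 'v \<Rightarrow> nat" where
  "level E r v = length (THE xs. graph_path E r xs v) - 1"

definition bounded_self_map :: "('v \<times> 'v) set \<Rightarrow> 'v \<Rightarrow> ('v \<Rightarrow> 'v) \<Rightarrow> bool" where
  "bounded_self_map E r \<phi> \<longleftrightarrow> bdd_above (range (\<lambda>v. level E r (\<phi> v)))"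

definition M_mean :: "('v \<times> 'v) set \<Rightarrow> 'v \<Rightarrow> real \<Rightarrow> nat \<Rightarrow> ('v \<Rightarrow> complex) \<Rightarrow> real" where
  "M_mean E r p n f =
     (if n = 0 then cmod (f r)
      else (1 / 2 * (\<Sum>v | level E r v = n. cmod (f v) powr p)) powr (1 / p))"

text \<open>
  The norm is extended-valued, so that it is meaningful for every function on the tree and
  membership in the space can be expressed by its finiteness.
\<close>

definition Tp_norm :: "('v \<times> 'v) set \<Rightarrow> 'v \<Rightarrow> real \<Rightarrow> ('v \<Rightarrow> complex) \<Rightarrow> ennreal" where
  "Tp_norm E r p f = (SUP n. ennreal (M_mean E r p n f))"

definition Tp_space :: "('v \<times> 'v) set \<Rightarrow> 'v \<Rightarrow> real \<Rightarrow> ('v \<Rightarrow> complex) set" where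
  "Tp_space E r p = {f. Tp_norm E r p f < \<infinity>}"

definition Tp_dist ::
  "('v \<times> 'v) set \<Rightarrow> 'v \<Rightarrow> real \<Rightarrow> ('v \<Rightarrow> complex) \<Rightarrow> ('v \<Rightarrow> complex) \<Rightarrow> real" where
  "Tp_dist E r p f g = enn2real (Tp_norm E r p (\<lambda>v. f v - g v))"

definition Tp_topology :: "('v \<times> 'v) set \<Rightarrow> 'v \<Rightarrow> real \<Rightarrow> ('v \<Rightarrow> complex) topology" where
  "Tp_topology E r p = Metric_space.mtopology (Tp_space E r p) (Tp_dist E r p)"

definition Tp_bounded_linear ::
  "('v \<times> 'v) set \<Rightarrow> 'v \<Rightarrow> real \<Rightarrow> (('v \<Rightarrow> complex) \<Rightarrow> ('v \<Rightarrow> complex)) \<Rightarrow> bool" where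
  "Tp_bounded_linear E r p A \<longleftrightarrow>
     A \<in> Tp_space E r p \<rightarrow> Tp_space E r p \<and>
     (\<forall>f \<in> Tp_space E r p. \<forall>g \<in> Tp_space E r p. A (\<lambda>v. f v + g v) = (\<lambda>v. A f v + A g v)) \<and>
     (\<forall>c. \<forall>f \<in> Tp_space E r p. A (\<lambda>v. c * f v) = (\<lambda>v. c * A f v)) \<and>
     (\<exists>K::real. \<forall>f \<in> Tp_space E r p. Tp_norm E r p (A f) \<le> ennreal K * Tp_norm E r p f)"

definition Tp_compact_operator ::
  "('v \<times> 'v) set \<Rightarrow> 'v \<Rightarrow> real \<Rightarrow> (('v \<Rightarrow> complex) \<Rightarrow> ('v \<Rightarrow> complex)) \<Rightarrow> bool" where
  "Tp_compact_operator E r p A \<longleftrightarrow>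
     Tp_bounded_linear E r p A \<and>
     compactin (Tp_topology E r p)
       (Tp_topology E r p closure_of (A ` {f. Tp_norm E r p f \<le> 1}))"

definition composition_operator :: "('v \<Rightarrow> 'v) \<Rightarrow> ('v \<Rightarrow> complex) \<Rightarrow> ('v \<Rightarrow> complex)" where
  "composition_operator \<phi> f = f \<circ> \<phi>"

end

theory Submission
  imports Defs
begin

text \<open>
  Spheres of the tree have at most two vertices, so \<open>\<parallel>f\<parallel>\<^sub>p \<le> sup |f| \<le> 2 \<parallel>f\<parallel>\<^sub>p\<close> and the space is
  \<open>\<ell>\<^sup>\<infinity>\<close> with an equivalent norm; since spheres are finite, \<open>\<phi>\<close> is bounded iff its range is
  finite. If the range is finite, the functions \<open>f \<circ> \<phi>\<close> with \<open>sup |f| \<le> 2\<close> form the continuous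
  image of a finite product of discs. Otherwise the indicators of single points of the range are
  mapped to infinitely many functions at mutual distance \<open>1\<close>.
\<close>

section \<open>Paths and spheres in the tree\<close>

text \<open>The cycle follows \<open>xs\<close> up to its first vertex on \<open>ys\<close> and returns along \<open>ys\<close>.\<close>

lemma two_paths_cycle:
  assumes sym: "sym E"
    and xs: "distinct (u # xs)" "successively (\<lambda>x y. (x, y) \<in> E) (u # xs)" "xs \<noteq> []"
    and ys: "distinct (u # ys)" "successively (\<lambda>x y. (x, y) \<in> E) (u # ys)" "ys \<noteq> []"
    and last: "last xs = last ys" and hd: "hd xs \<noteq> hd ys"
  shows "\<exists>c. graph_cycle E c"
proof -
  have "\<exists>z\<in>set xs. z \<in> set ys"
    using last xs(3) ys(3) by (metis last_in_set)
  then obtain p z s where p: "xs = p @ z # s" "z \<in> set ys" "\<forall>y\<in>set p. y \<notin> set ys"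
    using split_list_first_prop[of xs "\<lambda>z. z \<in> set ys"] by blast
  obtain q t where q: "ys = q @ z # t"
    using p(2) by (meson split_list)
  \<comment> \<open>If both prefixes were empty, both lists would start with \<open>z\<close>,
    against \<open>hd\<close>. Hence the cycle has a third vertex besides \<open>u\<close> and
    \<open>z\<close>.\<close>
  have ne: "p \<noteq> [] \<or> q \<noteq> []"
    using hd p(1) q by auto
  have E_sym: "(a, b) \<in> E \<longleftrightarrow> (b, a) \<in> E" for a b
    using sym by (meson symD)
  define c where "c = u # p @ z # rev q"
  have "3 \<le> length c"
    using ne by (cases p; cases q) (auto simp: c_def)
  \<comment> \<open>Since \<open>z\<close> is the first vertex of \<open>xs\<close> on
    \<open>ys\<close>, the prefix \<open>p\<close> is disjoint from \<open>q\<close>.\<close>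
  moreover have "distinct c"
    using xs(1) ys(1) p q by (auto simp: c_def)
  moreover have "successively (\<lambda>x y. (x, y) \<in> E) c"
  proof -
    have 1: "successively (\<lambda>x y. (x, y) \<in> E) (u # p @ [z])"
      using xs(2) p(1) successively_append_iff[of _ "u # p @ [z]" s] by simp
    have 2: "successively (\<lambda>x y. (x, y) \<in> E) (q @ [z])"
      using ys(2,3) q successively_append_iff[of _ "q @ [z]" t] by (simp add: successively_Cons)
    have "successively (\<lambda>x y. (y, x) \<in> E) (q @ [z])"
      by (rule successively_mono[OF 2]) (use E_sym in blast)
    then have "successively (\<lambda>x y. (x, y) \<in> E) (z # rev q)"
      using successively_rev[of "\<lambda>x y. (x, y) \<in> E" "q @ [z]"] by simp
    then show ?thesis
      using 1 successively_append_iff[of _ "u # p" "z # rev q"] successively_append_iff[of _ "u # p" "[z]"]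
      by (simp add: c_def)
  qed
  moreover have "(last c, hd c) \<in> E"
  proof -
    \<comment> \<open>Appending \<open>z\<close> covers the case of empty \<open>q\<close>, where
      \<open>c\<close> ends in \<open>z\<close>; otherwise \<open>c\<close> ends in
      \<open>hd q\<close>.\<close>
    have "(u, hd (q @ [z])) \<in> E"
      using ys(2) q by (auto simp: successively_Cons hd_append split: if_splits)
    then show ?thesis
      using E_sym by (cases q) (auto simp: c_def)
  qed
  ultimately show ?thesis
    unfolding graph_cycle_def by blast
qed

text \<open>Common first vertices are stripped by induction; where the two paths first diverge,
  \<open>two_paths_cycle\<close> produces a cycle.\<close>

lemma graph_path_unique:
  assumes "sym E" "\<nexists>c. graph_cycle E c"
    and "graph_path E u xs v" "graph_path E u ys v"
  shows "xs = ys"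
  using assms(3,4)
proof (induction xs arbitrary: u ys)
  case Nil
  then show ?case by (simp add: graph_path_def)
next
  case (Cons x xs)
  from Cons.prems obtain ys' where x: "x = u" and ys: "ys = u # ys'"
    by (cases ys) (auto simp: graph_path_def)
  consider "xs = []" | "ys' = []" | "xs \<noteq> []" "ys' \<noteq> []" by blast
  then show ?case
  proof cases
    case 1
    then have "v = u" using Cons.prems x by (simp add: graph_path_def)
    \<comment> \<open>A longer second path would have to return to \<open>u\<close>, against
      distinctness.\<close>
    then have "ys' = []"
      using Cons.prems(2) ys last_in_set[of ys'] by (auto simp: graph_path_def split: if_splits)
    with 1 x ys show ?thesis by simp
  next
    case 2
    then have "v = u" using Cons.prems ys by (simp add: graph_path_def)
    then have "xs = []"
      using Cons.prems(1) x last_in_set[of xs] by (auto simp: graph_path_def split: if_splits)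
    with 2 x ys show ?thesis by simp
  next
    case 3
    have "hd xs = hd ys'"
    proof (rule ccontr)
      assume "hd xs \<noteq> hd ys'"
      then have "\<exists>c. graph_cycle E c"
        using Cons.prems x ys 3
        by (intro two_paths_cycle[OF assms(1), of u xs ys']) (auto simp: graph_path_def)
      with assms(2) show False by blast
    qed
    then have "graph_path E (hd xs) xs v" "graph_path E (hd xs) ys' v"
      using Cons.prems x ys 3 by (auto simp: graph_path_def successively_Cons)
    then have "xs = ys'" by (rule Cons.IH)
    with x ys show ?thesis by simp
  qed
qed

section \<open>Counting the vertices of a sphere\<close>

definition paths_from :: "('v \<times> 'v) set \<Rightarrow> 'v \<Rightarrow> nat \<Rightarrow> 'v list set" where
  "paths_from E r n =
     {xs. length xs = Suc n \<and> hd xs = r \<and> distinct xs \<and> successively (\<lambda>x y. (x, y) \<in> E) xs}"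

text \<open>Only the first step is free: afterwards one of the two neighbours of the end vertex is
  its predecessor, so a path extends in at most one way. Hence \<open>butlast\<close> is injective
  on paths with at least two edges, and the count cannot grow.\<close>

lemma finite_card_paths_from:
  assumes E: "sym E" and deg: "\<And>v. card {w. (v, w) \<in> E} = 2"
  shows "finite (paths_from E r (Suc n)) \<and> card (paths_from E r (Suc n)) \<le> 2"
proof (induction n)
  case 0
  \<comment> \<open>\<open>card\<close> is 0 on infinite sets, so the value 2 forces
    finiteness.\<close>
  have fin: "finite {w. (r, w) \<in> E}"
    using deg[of r] by (metis card.infinite zero_neq_numeral)
  have "paths_from E r (Suc 0) \<subseteq> (\<lambda>w. [r, w]) ` {w. (r, w) \<in> E}"
    by (auto simp: paths_from_def length_Suc_conv)
  with fin show ?case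
    by (metis card_image_le card_mono deg finite_imageI le_trans rev_finite_subset)
next
  case (Suc n)
  have inj: "inj_on butlast (paths_from E r (Suc (Suc n)))"
  proof (rule inj_onI)
    fix xs ys
    assume xs: "xs \<in> paths_from E r (Suc (Suc n))" and ys: "ys \<in> paths_from E r (Suc (Suc n))"
      and eq: "butlast xs = butlast ys"
    have "xs \<noteq> []" "ys \<noteq> []" using xs ys by (auto simp: paths_from_def)
    then have xs1: "xs = butlast xs @ [last xs]" and ys1: "ys = butlast xs @ [last ys]"
      using eq by (metis append_butlast_last_id)+
    \<comment> \<open>\<open>xs\<close> has \<open>n + 3\<close> vertices, so at least two, ending
      in \<open>a\<close>, \<open>b\<close>, remain after truncation; \<open>a\<close> is the
      neighbour of \<open>b\<close> that the next step must avoid.\<close>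
    have "length (butlast xs) = Suc (Suc n)" using xs by (simp add: paths_from_def)
    then obtain zs a b where zs: "butlast xs = zs @ [a, b]"
      by (metis append_Cons append_Nil append_assoc length_Suc_conv_rev)
    have xs2: "xs = zs @ [a, b, last xs]" and ys2: "ys = zs @ [a, b, last ys]"
      using xs1 ys1 zs by simp_all
    have x: "successively (\<lambda>x y. (x, y) \<in> E) (zs @ [a, b, last xs])" "distinct (zs @ [a, b, last xs])"
      using xs unfolding paths_from_def using xs2 by auto
    have y: "successively (\<lambda>x y. (x, y) \<in> E) (zs @ [a, b, last ys])" "distinct (zs @ [a, b, last ys])"
      using ys unfolding paths_from_def using ys2 by auto
    have "(a, b) \<in> E"
      using x by (simp add: successively_append_iff)
    then have "a \<in> {w. (b, w) \<in> E}"
      using E by (simp add: symD)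
    moreover have "last xs \<in> {w. (b, w) \<in> E}" "last ys \<in> {w. (b, w) \<in> E}"
      "a \<noteq> last xs" "a \<noteq> last ys"
      using x y by (simp_all add: successively_append_iff)
    moreover obtain c d where "{w. (b, w) \<in> E} = {c, d}"
      using deg[of b] by (meson card_2_iff)
    ultimately have "last xs = last ys" by auto
    then show "xs = ys" using xs1 ys1 by metis
  qed
  have "butlast ` paths_from E r (Suc (Suc n)) \<subseteq> paths_from E r (Suc n)"
  proof (rule image_subsetI)
    fix xs assume xs: "xs \<in> paths_from E r (Suc (Suc n))"
    then have "xs \<noteq> []" by (auto simp: paths_from_def)
    then obtain ys y where ys: "xs = ys @ [y]" by (metis rev_exhaust)
    moreover from xs ys have "ys \<noteq> []" by (auto simp: paths_from_def)
    ultimately show "butlast xs \<in> paths_from E r (Suc n)"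
      using xs by (auto simp: paths_from_def successively_append_iff)
  qed
  with inj Suc.IH show ?case
    by (metis card_inj_on_le inj_on_finite le_trans)
qed

text \<open>Uniqueness of paths makes the definite description in \<open>level\<close> denote an
  actual path.\<close>

lemma level_path:
  assumes "two_homogeneous_tree E"
  obtains xs where "graph_path E r xs v" "level E r v = length xs - 1"
proof -
  obtain xs where xs: "graph_path E r xs v"
    using assms unfolding two_homogeneous_tree_def by blast
  have "(THE xs. graph_path E r xs v) = xs"
    using assms xs graph_path_unique
    by (intro the_equality) (auto simp: two_homogeneous_tree_def)
  with xs that show ?thesis by (simp add: level_def)
qed

lemma level_eq_0D:
  assumes "two_homogeneous_tree E" "level E r v = 0"
  shows "v = r"
proof -
  obtain xs where "graph_path E r xs v" "length xs - 1 = 0"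
    using level_path[OF assms(1), of r v] assms(2) by metis
  then show ?thesis by (cases xs) (auto simp: graph_path_def)
qed

text \<open>Every vertex of a sphere of positive radius is the end of a path in
  \<open>paths_from\<close>, so the bound on paths carries over through \<open>last\<close>.\<close>

lemma sphere_finite_card:
  assumes "two_homogeneous_tree E"
  shows "finite {v. level E r v = n} \<and> card {v. level E r v = n} \<le> 2"
proof (cases n)
  case 0
  then have "{v. level E r v = n} \<subseteq> {r}"
    using level_eq_0D[OF assms] by auto
  then show ?thesis
    using card_mono[of "{r}" "{v. level E r v = n}"] finite_subset by fastforce
next
  case (Suc m)
  have sub: "{v. level E r v = n} \<subseteq> last ` paths_from E r (Suc m)"
  proof
    fix v assume "v \<in> {v. level E r v = n}"
    then obtain xs where "graph_path E r xs v" "length xs - 1 = Suc m"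
      using level_path[OF assms, of r v] Suc by (metis mem_Collect_eq)
    then show "v \<in> last ` paths_from E r (Suc m)"
      by (intro image_eqI[of _ _ xs]) (auto simp: graph_path_def paths_from_def)
  qed
  have "finite (paths_from E r (Suc m)) \<and> card (paths_from E r (Suc m)) \<le> 2"
    using assms by (intro finite_card_paths_from) (auto simp: two_homogeneous_tree_def)
  with sub show ?thesis
    by (meson card_image_le card_mono finite_imageI finite_subset le_trans)
qed

lemma bounded_self_map_iff_finite_range:
  assumes "two_homogeneous_tree E"
  shows "bounded_self_map E r \<phi> \<longleftrightarrow> finite (range \<phi>)"
proof
  assume "bounded_self_map E r \<phi>"
  then obtain N where N: "\<And>v. level E r (\<phi> v) \<le> N"
    unfolding bounded_self_map_def bdd_above_def by auto
  have "range \<phi> \<subseteq> (\<Union>n\<le>N. {v. level E r v = n})"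
    using N by auto
  moreover have "finite (\<Union>n\<le>N. {v. level E r v = n})"
    using sphere_finite_card[OF assms] by blast
  ultimately show "finite (range \<phi>)" by (rule finite_subset)
next
  assume "finite (range \<phi>)"
  then have "finite (level E r ` range \<phi>)" by simp
  then show "bounded_self_map E r \<phi>"
    unfolding bounded_self_map_def by (metis bdd_above_finite image_image)
qed

section \<open>Comparison with the supremum norm\<close>

lemma powr_convex_combination:
  fixes x y t p :: real
  assumes p: "1 \<le> p" and x: "0 \<le> x" and y: "0 \<le> y" and t: "0 \<le> t" "t \<le> 1"
  shows "(t * x + (1 - t) * y) powr p \<le> t * x powr p + (1 - t) * y powr p"
proof -
  \<comment> \<open>If \<open>x\<close> or \<open>y\<close> is 0, the claim reduces to
    \<open>s powr p \<le> s\<close> on the unit interval; for positive arguments it is convexity of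
    the power.\<close>
  have scale: "(s * z) powr p \<le> s * z powr p" if "0 \<le> s" "s \<le> 1" "0 \<le> z" for s z :: real
  proof -
    have "s powr p \<le> s powr 1"
      using that p by (intro powr_mono') auto
    then show ?thesis
      using that by (simp add: powr_mult mult_right_mono)
  qed
  consider "x = 0" | "y = 0" | "0 < x" "0 < y" using x y by linarith
  then show ?thesis
  proof cases
    case 1
    then show ?thesis using scale[of "1 - t" y] y t p by simp
  next
    case 2
    then show ?thesis using scale[of t x] x t p by simp
  next
    case 3
    then show ?thesis
      using convex_onD[OF powr_convex[OF p], of "1 - t" x y] t by simp
  qed
qed

text \<open>Minkowski's inequality with the roots cleared: \<open>a i + b i\<close> is
  \<open>A + B\<close> times a convex combination of \<open>a i / A\<close> and
  \<open>b i / B\<close>, and convexity of the power is summed over \<open>S\<close>. The divisions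
  explain the positivity of \<open>A\<close> and \<open>B\<close>; \<open>k\<close> absorbs the
  normalising factor of the means.\<close>

lemma Minkowski_sum_powr:
  fixes a b :: "'a \<Rightarrow> real"
  assumes p: "1 \<le> p" and a: "\<And>i. i \<in> S \<Longrightarrow> 0 \<le> a i" and b: "\<And>i. i \<in> S \<Longrightarrow> 0 \<le> b i"
    and AB: "0 < A" "0 < B"
    and sa: "(\<Sum>i\<in>S. a i powr p) \<le> k * A powr p"
    and sb: "(\<Sum>i\<in>S. b i powr p) \<le> k * B powr p"
  shows "(\<Sum>i\<in>S. (a i + b i) powr p) \<le> k * (A + B) powr p"
proof -
  define t where "t = A / (A + B)"
  have t: "0 \<le> t" "t \<le> 1" "1 - t = B / (A + B)"
    using AB by (auto simp: t_def field_simps)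
  have "(a i + b i) powr p
      \<le> (A + B) powr p * (t * (a i powr p / A powr p) + (1 - t) * (b i powr p / B powr p))"
    if i: "i \<in> S" for i
  proof -
    have "a i + b i = (A + B) * (t * (a i / A) + (1 - t) * (b i / B))"
      unfolding t(3) using AB by (simp add: t_def distrib_left)
    then have "(a i + b i) powr p = (A + B) powr p * (t * (a i / A) + (1 - t) * (b i / B)) powr p"
      using t AB a[OF i] b[OF i] by (simp add: powr_mult)
    also have "(t * (a i / A) + (1 - t) * (b i / B)) powr p
        \<le> t * (a i / A) powr p + (1 - t) * (b i / B) powr p"
      using AB a[OF i] b[OF i] t by (intro powr_convex_combination p) auto
    finally show ?thesis
      using AB a[OF i] b[OF i] by (simp add: powr_divide)
  qed
  then have "(\<Sum>i\<in>S. (a i + b i) powr p)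
      \<le> (\<Sum>i\<in>S. (A + B) powr p * (t * (a i powr p / A powr p) + (1 - t) * (b i powr p / B powr p)))"
    by (rule sum_mono)
  also have "\<dots> = (A + B) powr p *
      (t * ((\<Sum>i\<in>S. a i powr p) / A powr p) + (1 - t) * ((\<Sum>i\<in>S. b i powr p) / B powr p))"
    unfolding sum_distrib_left[symmetric] sum.distrib sum_divide_distrib by simp
  also have "\<dots> \<le> (A + B) powr p * (t * k + (1 - t) * k)"
    using AB t sa sb by (intro mult_left_mono add_mono) (auto simp: divide_le_eq)
  also have "\<dots> = k * (A + B) powr p"
    by (simp add: algebra_simps)
  finally show ?thesis .
qed

section \<open>From means to pointwise bounds\<close>

lemma M_mean_le_iff:
  assumes "1 \<le> p" "0 \<le> c" "n \<noteq> 0"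
  shows "M_mean E r p n f \<le> c \<longleftrightarrow> (\<Sum>v | level E r v = n. cmod (f v) powr p) \<le> 2 * c powr p"
proof -
  let ?s = "\<Sum>v | level E r v = n. cmod (f v) powr p"
  have s: "0 \<le> ?s" by (intro sum_nonneg) simp
  have "M_mean E r p n f \<le> c \<longleftrightarrow> (1 / 2 * ?s) powr (1 / p) \<le> (c powr p) powr (1 / p)"
    using assms by (simp add: M_mean_def powr_powr)
  also have "\<dots> \<longleftrightarrow> 1 / 2 * ?s \<le> c powr p"
    using assms s powr_mono2[of "1 / p" "1 / 2 * ?s" "c powr p"]
      powr_less_mono2[of "1 / p" "c powr p" "1 / 2 * ?s"] by force
  finally show ?thesis by (simp add: mult.commute)
qed

text \<open>Lets later estimates work with plain sums of powers. The vertex \<open>r\<close> stands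
  apart because its mean carries no factor 1/2.\<close>

lemma Tp_norm_le_iff:
  assumes "1 \<le> p" "0 \<le> c"
  shows "Tp_norm E r p f \<le> ennreal c \<longleftrightarrow>
    cmod (f r) \<le> c \<and> (\<forall>n>0. (\<Sum>v | level E r v = n. cmod (f v) powr p) \<le> 2 * c powr p)"
proof -
  have "Tp_norm E r p f \<le> ennreal c \<longleftrightarrow> (\<forall>n. M_mean E r p n f \<le> c)"
    using assms by (simp add: Tp_norm_def SUP_le_iff)
  also have "\<dots> \<longleftrightarrow> M_mean E r p 0 f \<le> c \<and> (\<forall>n>0. M_mean E r p n f \<le> c)"
    by (metis gr0I)
  finally show ?thesis
    using assms by (simp add: M_mean_le_iff) (simp add: M_mean_def)
qed

text \<open>The factor 1/2 in the mean offsets the at most two vertices of a sphere.\<close>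

lemma Tp_norm_le_sup:
  assumes T: "two_homogeneous_tree E" and p: "1 \<le> p" and f: "\<And>v. cmod (f v) \<le> c"
  shows "Tp_norm E r p f \<le> ennreal c"
proof -
  have c: "0 \<le> c" using f[of r] norm_ge_zero order_trans by blast
  have "(\<Sum>v | level E r v = n. cmod (f v) powr p) \<le> 2 * c powr p" for n
  proof -
    have "(\<Sum>v | level E r v = n. cmod (f v) powr p) \<le> (\<Sum>v | level E r v = n. c powr p)"
      using f p by (intro sum_mono powr_mono2) auto
    also have "\<dots> \<le> 2 * c powr p"
      using sphere_finite_card[OF T, of r n] by (simp add: mult_right_mono)
    finally show ?thesis .
  qed
  with c p f show ?thesis by (simp add: Tp_norm_le_iff)
qed

text \<open>One term is at most the whole sum, hence at most \<open>2 * c powr p\<close>; then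
  \<open>2 \<le> 2 powr p\<close> gives a factor that does not depend on \<open>p\<close>.\<close>

lemma cmod_le_Tp_norm:
  assumes T: "two_homogeneous_tree E" and p: "1 \<le> p"
    and c: "Tp_norm E r p f \<le> ennreal c" "0 \<le> c"
  shows "cmod (f v) \<le> 2 * c"
proof (cases "level E r v = 0")
  case True
  with level_eq_0D[OF T] have "v = r" by simp
  with c p show ?thesis by (simp add: Tp_norm_le_iff)
next
  case False
  have "cmod (f v) powr p \<le> (\<Sum>w | level E r w = level E r v. cmod (f w) powr p)"
    using sphere_finite_card[OF T, of r "level E r v"]
    by (intro member_le_sum[of v _ "\<lambda>w. cmod (f w) powr p"]) auto
  also have "\<dots> \<le> 2 powr 1 * c powr p"
    using c p False by (simp add: Tp_norm_le_iff)
  also have "\<dots> \<le> 2 powr p * c powr p"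
    using p by (intro mult_right_mono powr_mono) auto
  also have "\<dots> = (2 * c) powr p"
    using c by (simp add: powr_mult)
  finally show ?thesis
    using p c powr_less_mono2[of p "2 * c" "cmod (f v)"] by force
qed

text \<open>Closure of the space under differences and composition thereby follows from facts about
  bounded functions.\<close>

lemma Tp_space_eq_bounded:
  assumes "two_homogeneous_tree E" "1 \<le> p"
  shows "Tp_space E r p = {f. bounded (range f)}"
proof (intro set_eqI iffI)
  fix f assume "f \<in> Tp_space E r p"
  then have "Tp_norm E r p f \<le> ennreal (enn2real (Tp_norm E r p f))"
    by (simp add: Tp_space_def)
  from cmod_le_Tp_norm[OF assms this enn2real_nonneg]
  show "f \<in> {f. bounded (range f)}" unfolding bounded_iff by blast
next
  fix f :: "'a \<Rightarrow> complex" assume "f \<in> {f. bounded (range f)}"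
  then obtain c where "\<And>v. cmod (f v) \<le> c" unfolding bounded_iff by auto
  from Tp_norm_le_sup[OF assms, of f c r, OF this]
  show "f \<in> Tp_space E r p" by (auto simp: Tp_space_def intro: le_less_trans)
qed

section \<open>The distance as a metric\<close>

lemma Tp_dist_le_sup:
  assumes T: "two_homogeneous_tree E" and p: "1 \<le> p" and fg: "\<And>v. cmod (f v - g v) \<le> c"
  shows "Tp_dist E r p f g \<le> c"
proof -
  have "0 \<le> c" using fg[of r] norm_ge_zero order_trans by blast
  moreover have "Tp_norm E r p (\<lambda>v. f v - g v) \<le> ennreal c"
    using fg by (rule Tp_norm_le_sup[OF T p])
  ultimately show ?thesis by (simp add: Tp_dist_def enn2real_leI)
qed

text \<open>\<open>enn2real\<close> sends infinity to 0, so the distance represents the norm of a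
  difference only where that norm is finite, as it is for members of the space.\<close>

lemma Tp_norm_diff_finite:
  assumes T: "two_homogeneous_tree E" and p: "1 \<le> p"
    and fg: "f \<in> Tp_space E r p" "g \<in> Tp_space E r p"
  shows "Tp_norm E r p (\<lambda>v. f v - g v) = ennreal (Tp_dist E r p f g)"
proof -
  have "bounded (range (\<lambda>v. f v - g v))"
    using fg by (intro bounded_minus_comp) (auto simp: Tp_space_eq_bounded[OF T p])
  then have "(\<lambda>v. f v - g v) \<in> Tp_space E r p"
    by (simp add: Tp_space_eq_bounded[OF T p])
  then show ?thesis by (simp add: Tp_space_def Tp_dist_def)
qed

text \<open>Serves both for definiteness of the distance and for separating the images of point
  indicators.\<close>

lemma cmod_diff_le_Tp_dist:
  assumes T: "two_homogeneous_tree E" and p: "1 \<le> p"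
    and fg: "f \<in> Tp_space E r p" "g \<in> Tp_space E r p"
  shows "cmod (f v - g v) \<le> 2 * Tp_dist E r p f g"
  using cmod_le_Tp_norm[OF T p, of r "\<lambda>v. f v - g v" "Tp_dist E r p f g" v]
  by (simp add: Tp_norm_diff_finite[OF assms]) (simp add: Tp_dist_def)

text \<open>Minkowski on each sphere, with \<open>k = 2\<close>, and the triangle inequality at
  \<open>r\<close>.\<close>

lemma Tp_norm_add_le:
  assumes p: "1 \<le> p" and AB: "0 < A" "0 < B"
    and f: "Tp_norm E r p f \<le> ennreal A" and g: "Tp_norm E r p g \<le> ennreal B"
  shows "Tp_norm E r p (\<lambda>v. f v + g v) \<le> ennreal (A + B)"
proof -
  have "(\<Sum>v | level E r v = n. cmod (f v + g v) powr p) \<le> 2 * (A + B) powr p" if "0 < n" for n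
  proof -
    have "(\<Sum>v | level E r v = n. cmod (f v + g v) powr p)
        \<le> (\<Sum>v | level E r v = n. (cmod (f v) + cmod (g v)) powr p)"
      using p by (intro sum_mono powr_mono2 norm_triangle_ineq) auto
    also have "\<dots> \<le> 2 * (A + B) powr p"
      using f g p AB that by (intro Minkowski_sum_powr) (auto simp: Tp_norm_le_iff)
    finally show ?thesis .
  qed
  moreover have "cmod (f r + g r) \<le> A + B"
    using f g p AB norm_triangle_ineq[of "f r" "g r"] by (simp add: Tp_norm_le_iff)
  ultimately show ?thesis
    using p AB by (subst Tp_norm_le_iff) auto
qed

lemma Metric_space_Tp:
  assumes T: "two_homogeneous_tree E" and p: "1 \<le> p"
  shows "Metric_space (Tp_space E r p) (Tp_dist E r p)"
proof
  fix f g
  show "0 \<le> Tp_dist E r p f g"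
    by (simp add: Tp_dist_def)
  show "Tp_dist E r p f g = Tp_dist E r p g f"
    by (simp only: Tp_dist_def Tp_norm_def M_mean_def norm_minus_commute[of "f _" "g _"])
next
  fix f g assume fg: "f \<in> Tp_space E r p" "g \<in> Tp_space E r p"
  show "Tp_dist E r p f g = 0 \<longleftrightarrow> f = g"
  proof
    assume "Tp_dist E r p f g = 0"
    then show "f = g"
      using cmod_diff_le_Tp_dist[OF T p fg] by (intro ext) simp
  next
    assume "f = g"
    then have "Tp_dist E r p f g \<le> 0"
      by (intro Tp_dist_le_sup[OF T p]) simp
    then show "Tp_dist E r p f g = 0"
      by (simp add: Tp_dist_def order_antisym)
  qed
next
  fix f g h assume fgh: "f \<in> Tp_space E r p" "g \<in> Tp_space E r p" "h \<in> Tp_space E r p"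
  let ?d = "Tp_dist E r p"
  show "?d f h \<le> ?d f g + ?d g h"
  proof (rule field_le_epsilon) \<comment> \<open>keeps the radii in \<open>Tp_norm_add_le\<close> positive\<close>
    fix e :: real assume e: "0 < e"
    have d0: "0 \<le> ?d f g" "0 \<le> ?d g h" by (simp_all add: Tp_dist_def)
    have "Tp_norm E r p (\<lambda>v. (f v - g v) + (g v - h v))
        \<le> ennreal ((?d f g + e / 2) + (?d g h + e / 2))"
      using e d0 by (intro Tp_norm_add_le[OF p])
        (auto simp: Tp_norm_diff_finite[OF T p] fgh intro!: ennreal_leI)
    then have "enn2real (Tp_norm E r p (\<lambda>v. f v - h v)) \<le> (?d f g + e / 2) + (?d g h + e / 2)"
      using e d0 by (intro enn2real_leI) auto
    then show "?d f h \<le> ?d f g + ?d g h + e"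
      by (simp add: Tp_dist_def[of E r p f h])
  qed
qed

section \<open>The composition operator\<close>

text \<open>The supremum of \<open>f \<circ> \<phi>\<close> is at most that of \<open>f\<close>, so
  the constant 2 serves every \<phi>; compactness then depends only on the image of the unit
  ball.\<close>

lemma composition_operator_bounded_linear:
  assumes T: "two_homogeneous_tree E" and p: "1 \<le> p"
  shows "Tp_bounded_linear E r p (composition_operator \<phi>)"
  unfolding Tp_bounded_linear_def
proof (intro conjI)
  show "composition_operator \<phi> \<in> Tp_space E r p \<rightarrow> Tp_space E r p"
    unfolding Tp_space_eq_bounded[OF T p]
    by (fastforce simp: composition_operator_def bounded_iff)
  have "Tp_norm E r p (composition_operator \<phi> f) \<le> ennreal 2 * Tp_norm E r p f"
    if "f \<in> Tp_space E r p" for f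
  proof -
    let ?c = "enn2real (Tp_norm E r p f)"
    have c: "ennreal ?c = Tp_norm E r p f"
      using that by (simp add: Tp_space_def)
    then have "\<And>v. cmod (f v) \<le> 2 * ?c"
      using cmod_le_Tp_norm[OF T p, of r f ?c] by simp
    then have "Tp_norm E r p (composition_operator \<phi> f) \<le> ennreal (2 * ?c)"
      by (intro Tp_norm_le_sup[OF T p]) (simp add: composition_operator_def)
    also have "\<dots> = ennreal 2 * Tp_norm E r p f"
      by (subst ennreal_mult) (simp_all add: c)
    finally show ?thesis .
  qed
  then show "\<exists>K::real. \<forall>f\<in>Tp_space E r p.
      Tp_norm E r p (composition_operator \<phi> f) \<le> ennreal K * Tp_norm E r p f"
    by blast
qed (auto simp: composition_operator_def)

section \<open>Finite range and compactness\<close>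

lemma compactin_comp_finite_range:
  fixes \<phi> :: "'v \<Rightarrow> 'v"
  assumes T: "two_homogeneous_tree E" and p: "1 \<le> p" and fin: "finite (range \<phi>)"
  shows "compactin (Tp_topology E r p) ((\<lambda>f. f \<circ> \<phi>) ` {f. \<forall>v. cmod (f v) \<le> c})"
  unfolding Tp_topology_def
proof -
  interpret Metric_space "Tp_space E r p" "Tp_dist E r p"
    by (rule Metric_space_Tp[OF T p])
  let ?X = "product_topology (\<lambda>_. euclidean) (range \<phi>) :: ('v \<Rightarrow> complex) topology"
  let ?K = "PiE (range \<phi>) (\<lambda>_. cball (0 :: complex) c)"
  have mem: "f \<circ> \<phi> \<in> Tp_space E r p" for f :: "'v \<Rightarrow> complex"
    unfolding Tp_space_eq_bounded[OF T p] mem_Collect_eq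
    using fin by (metis finite_imageI finite_imp_bounded image_comp)
  have "continuous_map ?X mtopology (\<lambda>f. f \<circ> \<phi>)"
    unfolding continuous_map_to_metric
  proof (intro ballI allI impI)
    fix f and e :: real assume f: "f \<in> topspace ?X" and e: "0 < e"
    \<comment> \<open>The box is open because the range is finite. Its radius is halved because the
      passage to the norm yields only a weak inequality.\<close>
    let ?U = "PiE (range \<phi>) (\<lambda>w. ball (f w) (e / 2))"
    have "openin ?X ?U"
      using fin by (simp add: openin_PiE)
    moreover have "f \<in> ?U" using f e by (auto simp: PiE_iff)
    moreover have "g \<circ> \<phi> \<in> mball (f \<circ> \<phi>) e" if g: "g \<in> ?U" for g
    proof -
      have "cmod ((f \<circ> \<phi>) v - (g \<circ> \<phi>) v) \<le> e / 2" for v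
        using g by (auto simp: PiE_iff dist_norm intro: less_imp_le)
      then have "Tp_dist E r p (f \<circ> \<phi>) (g \<circ> \<phi>) \<le> e / 2"
        by (rule Tp_dist_le_sup[OF T p])
      then show ?thesis using mem e by simp
    qed
    ultimately show "\<exists>U. openin ?X U \<and> f \<in> U \<and> (\<forall>g\<in>U. g \<circ> \<phi> \<in> mball (f \<circ> \<phi>) e)"
      by blast
  qed
  moreover have "compactin ?X ?K"
    by (simp add: compactin_PiE)
  ultimately have "compactin mtopology ((\<lambda>f. f \<circ> \<phi>) ` ?K)"
    by (rule image_compactin[rotated])
  \<comment> \<open>Elements of \<open>?K\<close> are \<open>undefined\<close> off the range:
    restriction leads one way and extension by 0 the other, and composing with \<phi> forgets the
    difference.\<close>
  moreover have "(\<lambda>f. f \<circ> \<phi>) ` {f. \<forall>v. cmod (f v) \<le> c} = (\<lambda>f. f \<circ> \<phi>) ` ?K"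
  proof (intro equalityI image_subsetI)
    fix f :: "'v \<Rightarrow> complex" assume "f \<in> {f. \<forall>v. cmod (f v) \<le> c}"
    then show "f \<circ> \<phi> \<in> (\<lambda>f. f \<circ> \<phi>) ` ?K"
      by (intro image_eqI[of _ _ "restrict f (range \<phi>)"]) (auto simp: fun_eq_iff)
  next
    fix f assume f: "f \<in> ?K"
    then have "cmod (f (\<phi> v)) \<le> c" for v by (auto simp: PiE_iff)
    \<comment> \<open>Ensures that the value 0 used off the range also obeys the bound.\<close>
    moreover from this have "0 \<le> c" using norm_ge_zero order_trans by blast
    ultimately show "f \<circ> \<phi> \<in> (\<lambda>f. f \<circ> \<phi>) ` {f. \<forall>v. cmod (f v) \<le> c}"
      by (intro image_eqI[of _ _ "\<lambda>w. if w \<in> range \<phi> then f w else 0"]) (auto simp: fun_eq_iff)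
  qed
  ultimately show "compactin mtopology ((\<lambda>f. f \<circ> \<phi>) ` {f. \<forall>v. cmod (f v) \<le> c})" by simp
qed

text \<open>The indicators of range points, composed with \<phi>, are pairwise at least 1/2 apart,
  so a finite net of that radius chosen among them must contain them all.\<close>

lemma finite_range_if_mtotally_bounded:
  fixes \<phi> :: "'v \<Rightarrow> 'v"
  assumes T: "two_homogeneous_tree E" and p: "1 \<le> p"
    and tb: "Metric_space.mtotally_bounded (Tp_space E r p) (Tp_dist E r p)
      ((\<lambda>f. f \<circ> \<phi>) ` {f. \<forall>v. cmod (f v) \<le> 1})"
  shows "finite (range \<phi>)"
proof -
  interpret Metric_space "Tp_space E r p" "Tp_dist E r p"
    by (rule Metric_space_Tp[OF T p])
  define b :: "'v \<Rightarrow> 'v \<Rightarrow> complex" where "b w = indicator {w} \<circ> \<phi>" for w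
  have b: "b w v = (if \<phi> v = w then 1 else 0)" for w v
    by (simp add: b_def)
  have mem: "b w \<in> Tp_space E r p" for w
    unfolding Tp_space_eq_bounded[OF T p] bounded_iff mem_Collect_eq
    by (rule exI[of _ 1]) (auto simp: b)
  \<comment> \<open>At a preimage of \<open>u\<close> the two functions differ by 1; the factor 2 in
    \<open>cmod_diff_le_Tp_dist\<close> turns this into 1/2.\<close>
  have sep: "1 / 2 \<le> Tp_dist E r p (b u) (b w)" if uw: "u \<in> range \<phi>" "u \<noteq> w" for u w
  proof -
    obtain v where "\<phi> v = u" using uw(1) by blast
    then have "cmod (b u v - b w v) = 1" using uw(2) by (simp add: b)
    with cmod_diff_le_Tp_dist[OF T p mem[of u] mem[of w], of v] show ?thesis by simp
  qed
  have "b ` range \<phi> \<subseteq> (\<lambda>f. f \<circ> \<phi>) ` {f. \<forall>v. cmod (f v) \<le> 1}"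
    unfolding b_def by (auto simp: indicator_def)
  with tb have "mtotally_bounded (b ` range \<phi>)"
    by (rule mtotally_bounded_subset)
  then obtain K where K: "finite K" "K \<subseteq> b ` range \<phi>" "b ` range \<phi> \<subseteq> (\<Union>x\<in>K. mball x (1 / 2))"
    unfolding mtotally_bounded_def by (meson half_gt_zero zero_less_one)
  have "b ` range \<phi> \<subseteq> K"
  proof (rule image_subsetI)
    fix w assume w: "w \<in> range \<phi>"
    then obtain x where x: "x \<in> K" "b w \<in> mball x (1 / 2)" using K(3) by blast
    with K(2) obtain u where u: "u \<in> range \<phi>" "x = b u" by blast
    with x sep[of u w] have "u = w" by force
    with x u show "b w \<in> K" by simp
  qed
  then have "finite (b ` range \<phi>)" using K(1) by (rule finite_subset)
  \<comment> \<open>For \<open>u\<close> in the range, \<open>b u\<close> takes the value 1 at a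
    preimage of \<open>u\<close>, where \<open>b w\<close> vanishes unless
    \<open>w = u\<close>.\<close>
  moreover have "inj_on b (range \<phi>)"
  proof (rule inj_onI)
    fix u w assume "u \<in> range \<phi>" "b u = b w"
    then show "u = w" using b by (metis (full_types) imageE zero_neq_one)
  qed
  ultimately show ?thesis by (rule finite_imageD)
qed

theorem corollary8:
  fixes E :: "('v \<times> 'v) set" and r :: 'v and \<phi> :: "'v \<Rightarrow> 'v" and p :: real
  assumes "two_homogeneous_tree E"
    and "1 \<le> p"
  shows "Tp_compact_operator E r p (composition_operator \<phi>) \<longleftrightarrow> bounded_self_map E r \<phi>"
proof -
  interpret Metric_space "Tp_space E r p" "Tp_dist E r p"
    by (rule Metric_space_Tp[OF assms])
  let ?A = "(\<lambda>f. f \<circ> \<phi>) ` {f. Tp_norm E r p f \<le> 1}"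
  let ?B = "\<lambda>c. {f :: 'v \<Rightarrow> complex. \<forall>v. cmod (f v) \<le> c}"
  \<comment> \<open>The unit ball lies between the supremum balls of radius 1 and 2: the inner one
    shows that a finite range is necessary, the outer one that it suffices.\<close>
  have low: "?B 1 \<subseteq> {f. Tp_norm E r p f \<le> 1}"
    using Tp_norm_le_sup[OF assms, of _ 1 r] by auto
  have up: "{f. Tp_norm E r p f \<le> 1} \<subseteq> ?B 2"
    using cmod_le_Tp_norm[OF assms, of r _ 1] by auto
  have M: "?A \<subseteq> Tp_space E r p"
    unfolding Tp_space_eq_bounded[OF assms] using up by (fastforce simp: bounded_iff)
  have "Tp_compact_operator E r p (composition_operator \<phi>)
      \<longleftrightarrow> compactin mtopology (mtopology closure_of ?A)"
    by (simp add: Tp_compact_operator_def composition_operator_bounded_linear[OF assms]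
        Tp_topology_def composition_operator_def)
  also have "\<dots> \<longleftrightarrow> finite (range \<phi>)"
  proof
    assume "compactin mtopology (mtopology closure_of ?A)"
    then have "mtotally_bounded (mtopology closure_of ?A)"
      by (rule compactin_imp_mtotally_bounded)
    moreover have "(\<lambda>f. f \<circ> \<phi>) ` ?B 1 \<subseteq> mtopology closure_of ?A"
      using M by (intro order_trans[OF image_mono[OF low]] closure_of_subset) simp
    ultimately have "mtotally_bounded ((\<lambda>f. f \<circ> \<phi>) ` ?B 1)"
      by (rule mtotally_bounded_subset)
    then show "finite (range \<phi>)"
      by (rule finite_range_if_mtotally_bounded[OF assms])
  next
    assume "finite (range \<phi>)"
    then have cpt: "compactin mtopology ((\<lambda>f. f \<circ> \<phi>) ` ?B 2)"
      using compactin_comp_finite_range[OF assms] by (simp add: Tp_topology_def)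
    \<comment> \<open>Being closed, this compact set contains the closure of \<open>?A\<close>,
      which is therefore compact.\<close>
    then have "closedin mtopology ((\<lambda>f. f \<circ> \<phi>) ` ?B 2)"
      by (rule compactin_imp_closedin[OF Hausdorff_space_mtopology])
    then have "mtopology closure_of ?A \<subseteq> (\<lambda>f. f \<circ> \<phi>) ` ?B 2"
      using image_mono[OF up] by (intro closure_of_minimal)
    with cpt show "compactin mtopology (mtopology closure_of ?A)"
      by (rule closed_compactin) simp
  qed
  finally show ?thesis
    by (simp add: bounded_self_map_iff_finite_range[OF assms(1)])
qed

end
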